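(* Let $q\in(0,1)$, $\omega\ge 0$, let $I$ be a real interval containing $\omega_0=\frac{\omega}{1-q}$, let $a,b\in I$ with $a<b$, let $r\in\mathbb N$ and let $\alpha_i,\beta_i\in\mathbb R$ ($i=0,\dots,r-1$). Let $L(t,u_0,\dots,u_r)$ be a real function on $I\times\mathbb R^{r+1}$. Consider the problem of extremizing (minimizing or maximizing) $$\mathcal L[y]=\int_a^b L\left(t,y^{\sigma^r}(t),D_{q,\omega}[y^{\sigma^{r-1}}](t),\dots,D_{q,\omega}^r[y](t)\right)d_{q,\omega}t$$ over all $y\in\mathcal Y^r([a,b],\mathbb R)$ with $D_{q,\omega}^i[y](a)=\alpha_i$ and $D_{q,\omega}^i[y](b)=\beta_i$ for $i=0,\dots,r-1$ (such $y$ are called admissible). Assume: (i) $(u_0,\dots,u_r)\mapsto L(t,u_0,\dots,u_r)$ is a $C^1(\mathbb R^{r+1},\mathbb R)$ function for every $t\in[a,b]$; (ii) $t\mapsto L(t,y(t),D_{q,\omega}[y](t),\dots,D_{q,\omega}^r[y](t))$ is continuous at $\omega_0$ for every admissible $y$; (iii) for every admissible $y$ and $i=0,1,\dots,r$, the function $t\mapsto\partial_{i+2}L(t,y(t),D_{q,\omega}[y](t),\dots,D_{q,\omega}^r[y](t))$ belongs to $\mathcal Y^1([a,b],\mathbb R)$; (iv) for every admissible $y$ and every variation $\eta$, putting $$g(t,\epsilon)=L\left(t,y^{\sigma^r}(t)+\epsilon\eta^{\sigma^r}(t),D_{q,\omega}[y^{\sigma^{r-1}}](t)+\epsilon D_{q,\omega}[\eta^{\sigma^{r-1}}](t),\dots,D_{q,\omega}^r[y](t)+\epsilon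 D^r_{q,\omega}[\eta](t)\right),$$ the function $g(t,\cdot)$ is differentiable at $0$ uniformly in $[a,b]_{q,\omega}$; the integrals $\int_{\omega_0}^a g(t,\epsilon)\,d_{q,\omega}t$ and $\int_{\omega_0}^b g(t,\epsilon)\,d_{q,\omega}t$ exist for all $\epsilon$ near $0$; and the integrals $\int_{\omega_0}^a\partial_2g(t,0)\,d_{q,\omega}t$ and $\int_{\omega_0}^b\partial_2g(t,0)\,d_{q,\omega}t$ exist. If $y_*\in\mathcal Y^r$ is a local extremizer (local minimizer or local maximizer) of this problem, then $y=y_*$ satisfies $$\sum_{i=0}^r(-1)^i\left(\frac1q\right)^{\frac{(i-1)i}{2}}D_{q,\omega}^i\left[\tau\mapsto\partial_{i+2}L\left(\tau,y^{\sigma^r}(\tau),D_{q,\omega}[y^{\sigma^{r-1}}](\tau),\dots,D_{q,\omega}^r[y](\tau)\right)\right](t)=0$$ for all $t\in[a,b]_{q,\omega}$.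
   Context: Hahn derivative: for $f:I\to\mathbb R$, $D_{q,\omega}[f](t)=\frac{f(qt+\omega)-f(t)}{(q-1)t+\omega}$ if $t\ne\omega_0$, and $D_{q,\omega}[f](\omega_0)=f'(\omega_0)$ provided $f$ is differentiable at $\omega_0$. $D^0_{q,\omega}[f]=f$ and $D^r_{q,\omega}[f]=D_{q,\omega}[D^{r-1}_{q,\omega}[f]]$. Notation: $\sigma(t)=qt+\omega$; $y^{\sigma^k}=y\circ\sigma\circ\cdots\circ\sigma$ ($k$ times), $y^{\sigma^0}=y$; $[k]_q=\frac{1-q^k}{1-q}$. $\partial_jL$ is the partial derivative of $L$ with respect to its $j$th argument. Integral: $\int_a^b f\,d_{q,\omega}t=\int_{\omega_0}^b f\,d_{q,\omega}t-\int_{\omega_0}^a f\,d_{q,\omega}t$, where $\int_{\omega_0}^x f(t)\,d_{q,\omega}t=(x(1-q)-\omega)\sum_{k=0}^{\infty}q^kf(q^kx+\omega[k]_q)$; an integral exists when the series converge. Set: $[a,b]_{q,\omega}=\{q^na+\omega[n]_q:n\ge0\}\cup\{q^nb+\omega[n]_q:n\ge0\}\cup\{\omega_0\}$. Space: $\mathcal Y^r=\mathcal Y^r([a,b],\mathbb R)$ is the set of $y:I\to\mathbb R$ such that $D^i_{q,\omega}[y]$, $i=0,\dots,r$, are bounded on $[a,b]_{q,\omega}$ and continuous at $\omega_0$, with norm $\|y\|_{r,\infty}=\sum_{i=0}^r\sup_{t\in[a,b]_{q,\omega}}|D^i_{q,\omega}[y](t)|$. A variation is an $\eta\in\mathcal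 Y^r$ with $D^i_{q,\omega}[\eta](a)=D^i_{q,\omega}[\eta](b)=0$ for $i=0,\dots,r-1$. An admissible $y_*$ is a local minimizer (resp. maximizer) if there is $\delta>0$ with $\mathcal L[y_*]\le\mathcal L[y]$ (resp. $\ge$) for all admissible $y$ with $\|y_*-y\|_{r,\infty}<\delta$. $g(t,\cdot)$ is differentiable at $\theta_0$ uniformly in a set $S$ if for every $\varepsilon>0$ there is $\delta>0$ such that $0<|\theta-\theta_0|<\delta$ implies $\left|\frac{g(t,\theta)-g(t,\theta_0)}{\theta-\theta_0}-\partial_2g(t,\theta_0)\right|<\varepsilon$ for all $t\in S$, where $\partial_2g=\partial g/\partial\theta$.
   Formalization: Added: neither a nor b is of the form σ^n of the other; (i) is also assumed for t in [a,b]_{q,ω}; at t=ω_0 the equation is asserted only if each function τ↦∂_{i+2}L(τ,y^{σ^r}(τ),…) in it lies in Y^i. The statement fails or is undefined without these. *)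

theory Defs
  imports "HOL-Analysis.Analysis"
begin

definition hahn_omega0 :: "real \<Rightarrow> real \<Rightarrow> real" where
  "hahn_omega0 q \<omega> = \<omega> / (1 - q)"

definition hahn_sigma :: "real \<Rightarrow> real \<Rightarrow> real \<Rightarrow> real" where
  "hahn_sigma q \<omega> t = q * t + \<omega>"

definition hahn_shift :: "real \<Rightarrow> real \<Rightarrow> nat \<Rightarrow> (real \<Rightarrow> real) \<Rightarrow> real \<Rightarrow> real" where
  "hahn_shift q \<omega> k y = y \<circ> (hahn_sigma q \<omega> ^^ k)"

definition q_bracket :: "real \<Rightarrow> nat \<Rightarrow> real" where
  "q_bracket q k = (1 - q ^ k) / (1 - q)"

(* A function I \<rightarrow> \<real> is represented by a total function whose values outside I are
   irrelevant. Consequently derivatives and continuity at the fixed point are taken within I,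
   which may have the fixed point as an end point. The value of the first branch
   is meaningful only if f is differentiable there. *)
definition hahn_deriv :: "real \<Rightarrow> real \<Rightarrow> real set \<Rightarrow> (real \<Rightarrow> real) \<Rightarrow> real \<Rightarrow> real" where
  "hahn_deriv q \<omega> I f t =
     (if t = hahn_omega0 q \<omega> then vector_derivative f (at (hahn_omega0 q \<omega>) within I)
      else (f (q * t + \<omega>) - f t) / ((q - 1) * t + \<omega>))"

definition hahn_derivs :: "real \<Rightarrow> real \<Rightarrow> real set \<Rightarrow> nat \<Rightarrow> (real \<Rightarrow> real) \<Rightarrow> real \<Rightarrow> real" where
  "hahn_derivs q \<omega> I r f = (hahn_deriv q \<omega> I ^^ r) f"

definition hahn_orbit :: "real \<Rightarrow> real \<Rightarrow> real \<Rightarrow> real set" where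
  "hahn_orbit q \<omega> x = {q ^ n * x + \<omega> * q_bracket q n | n. True}"

definition hahn_interval :: "real \<Rightarrow> real \<Rightarrow> real \<Rightarrow> real \<Rightarrow> real set" where
  "hahn_interval q \<omega> a b = hahn_orbit q \<omega> a \<union> hahn_orbit q \<omega> b \<union> {hahn_omega0 q \<omega>}"

definition hahn_integrable0 :: "real \<Rightarrow> real \<Rightarrow> real \<Rightarrow> (real \<Rightarrow> real) \<Rightarrow> bool" where
  "hahn_integrable0 q \<omega> x f \<longleftrightarrow> summable (\<lambda>k. q ^ k * f (q ^ k * x + \<omega> * q_bracket q k))"

definition hahn_integral0 :: "real \<Rightarrow> real \<Rightarrow> real \<Rightarrow> (real \<Rightarrow> real) \<Rightarrow> real" where
  "hahn_integral0 q \<omega> x f =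
     (x * (1 - q) - \<omega>) * (\<Sum>k. q ^ k * f (q ^ k * x + \<omega> * q_bracket q k))"

definition hahn_integral :: "real \<Rightarrow> real \<Rightarrow> real \<Rightarrow> real \<Rightarrow> (real \<Rightarrow> real) \<Rightarrow> real" where
  "hahn_integral q \<omega> a b f = hahn_integral0 q \<omega> b f - hahn_integral0 q \<omega> a f"

(* The differentiability clause says that the Hahn derivatives up to order r exist at the fixed
   point; elsewhere they always exist. *)
definition hahn_Y :: "real \<Rightarrow> real \<Rightarrow> real set \<Rightarrow> real \<Rightarrow> real \<Rightarrow> nat \<Rightarrow> (real \<Rightarrow> real) set" where
  "hahn_Y q \<omega> I a b r =
     {y. (\<forall>i<r. hahn_derivs q \<omega> I i y differentiable (at (hahn_omega0 q \<omega>) within I)) \<and>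
         (\<forall>i\<le>r. bounded (hahn_derivs q \<omega> I i y ` hahn_interval q \<omega> a b) \<and>
                continuous (at (hahn_omega0 q \<omega>) within I) (hahn_derivs q \<omega> I i y))}"

definition hahn_norm ::
  "real \<Rightarrow> real \<Rightarrow> real set \<Rightarrow> real \<Rightarrow> real \<Rightarrow> nat \<Rightarrow> (real \<Rightarrow> real) \<Rightarrow> real" where
  "hahn_norm q \<omega> I a b r y =
     (\<Sum>i\<le>r. SUP t\<in>hahn_interval q \<omega> a b. \<bar>hahn_derivs q \<omega> I i y t\<bar>)"

(* \<real>^n with n a term: functions on the naturals that vanish from n on. On it the product
   topology of nat \<Rightarrow> real is the Euclidean one. *)
definition real_tuples :: "nat \<Rightarrow> (nat \<Rightarrow> real) set" where
  "real_tuples n = {u. \<forall>j\<ge>n. u j = 0}"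

definition partial :: "nat \<Rightarrow> ((nat \<Rightarrow> real) \<Rightarrow> real) \<Rightarrow> (nat \<Rightarrow> real) \<Rightarrow> real" where
  "partial j F u = deriv (\<lambda>x. F (u(j := x))) (u j)"

definition C1_tuples :: "nat \<Rightarrow> ((nat \<Rightarrow> real) \<Rightarrow> real) \<Rightarrow> bool" where
  "C1_tuples n F \<longleftrightarrow>
     (\<forall>j<n. (\<forall>u\<in>real_tuples n. (\<lambda>x. F (u(j := x))) field_differentiable (at (u j))) \<and>
            continuous_on (real_tuples n) (partial j F))"

definition hahn_jet ::
  "real \<Rightarrow> real \<Rightarrow> real set \<Rightarrow> nat \<Rightarrow> (real \<Rightarrow> real) \<Rightarrow> real \<Rightarrow> nat \<Rightarrow> real" where
  "hahn_jet q \<omega> I r y t = (\<lambda>i. if i \<le> r then hahn_derivs q \<omega> I i y t else 0)"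

definition hahn_shifted_jet ::
  "real \<Rightarrow> real \<Rightarrow> real set \<Rightarrow> nat \<Rightarrow> (real \<Rightarrow> real) \<Rightarrow> real \<Rightarrow> nat \<Rightarrow> real" where
  "hahn_shifted_jet q \<omega> I r y t =
     (\<lambda>i. if i \<le> r then hahn_derivs q \<omega> I i (hahn_shift q \<omega> (r - i) y) t else 0)"

definition hahn_functional ::
  "real \<Rightarrow> real \<Rightarrow> real set \<Rightarrow> real \<Rightarrow> real \<Rightarrow> nat \<Rightarrow> (real \<Rightarrow> (nat \<Rightarrow> real) \<Rightarrow> real) \<Rightarrow>
   (real \<Rightarrow> real) \<Rightarrow> real" where
  "hahn_functional q \<omega> I a b r L y =
     hahn_integral q \<omega> a b (\<lambda>t. L t (hahn_shifted_jet q \<omega> I r y t))"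

definition hahn_admissible ::
  "real \<Rightarrow> real \<Rightarrow> real set \<Rightarrow> real \<Rightarrow> real \<Rightarrow> nat \<Rightarrow> (nat \<Rightarrow> real) \<Rightarrow> (nat \<Rightarrow> real) \<Rightarrow>
   (real \<Rightarrow> real) set" where
  "hahn_admissible q \<omega> I a b r \<alpha> \<beta> =
     {y \<in> hahn_Y q \<omega> I a b r.
        \<forall>i<r. hahn_derivs q \<omega> I i y a = \<alpha> i \<and> hahn_derivs q \<omega> I i y b = \<beta> i}"

definition hahn_variations ::
  "real \<Rightarrow> real \<Rightarrow> real set \<Rightarrow> real \<Rightarrow> real \<Rightarrow> nat \<Rightarrow> (real \<Rightarrow> real) set" where
  "hahn_variations q \<omega> I a b r = hahn_admissible q \<omega> I a b r (\<lambda>_. 0) (\<lambda>_. 0)"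

definition hahn_local_minimizer ::
  "real \<Rightarrow> real \<Rightarrow> real set \<Rightarrow> real \<Rightarrow> real \<Rightarrow> nat \<Rightarrow> (nat \<Rightarrow> real) \<Rightarrow> (nat \<Rightarrow> real) \<Rightarrow>
   (real \<Rightarrow> (nat \<Rightarrow> real) \<Rightarrow> real) \<Rightarrow> (real \<Rightarrow> real) \<Rightarrow> bool" where
  "hahn_local_minimizer q \<omega> I a b r \<alpha> \<beta> L y0 \<longleftrightarrow>
     y0 \<in> hahn_admissible q \<omega> I a b r \<alpha> \<beta> \<and>
     (\<exists>\<delta>>0. \<forall>y\<in>hahn_admissible q \<omega> I a b r \<alpha> \<beta>.
        hahn_norm q \<omega> I a b r (\<lambda>t. y0 t - y t) < \<delta> \<longrightarrow>
        hahn_functional q \<omega> I a b r L y0 \<le> hahn_functional q \<omega> I a b r L y)"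

definition hahn_local_maximizer ::
  "real \<Rightarrow> real \<Rightarrow> real set \<Rightarrow> real \<Rightarrow> real \<Rightarrow> nat \<Rightarrow> (nat \<Rightarrow> real) \<Rightarrow> (nat \<Rightarrow> real) \<Rightarrow>
   (real \<Rightarrow> (nat \<Rightarrow> real) \<Rightarrow> real) \<Rightarrow> (real \<Rightarrow> real) \<Rightarrow> bool" where
  "hahn_local_maximizer q \<omega> I a b r \<alpha> \<beta> L y0 \<longleftrightarrow>
     y0 \<in> hahn_admissible q \<omega> I a b r \<alpha> \<beta> \<and>
     (\<exists>\<delta>>0. \<forall>y\<in>hahn_admissible q \<omega> I a b r \<alpha> \<beta>.
        hahn_norm q \<omega> I a b r (\<lambda>t. y0 t - y t) < \<delta> \<longrightarrow>
        hahn_functional q \<omega> I a b r L y0 \<ge> hahn_functional q \<omega> I a b r L y)"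

(* The estimate itself forces the difference quotients to converge to the number
   deriv (g t) \<theta>0, so differentiability of g t at \<theta>0 need not be stated separately. *)
definition uniformly_diff_at :: "(real \<Rightarrow> real \<Rightarrow> real) \<Rightarrow> real \<Rightarrow> real set \<Rightarrow> bool" where
  "uniformly_diff_at g \<theta>0 S \<longleftrightarrow>
     (\<forall>\<epsilon>>0. \<exists>\<delta>>0. \<forall>\<theta>. 0 < \<bar>\<theta> - \<theta>0\<bar> \<and> \<bar>\<theta> - \<theta>0\<bar> < \<delta> \<longrightarrow>
        (\<forall>t\<in>S. \<bar>(g t \<theta> - g t \<theta>0) / (\<theta> - \<theta>0) - deriv (g t) \<theta>0\<bar> < \<epsilon>))"

definition hahn_variation_regular ::
  "real \<Rightarrow> real \<Rightarrow> real \<Rightarrow> real \<Rightarrow> (real \<Rightarrow> real \<Rightarrow> real) \<Rightarrow> bool" where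
  "hahn_variation_regular q \<omega> a b g \<longleftrightarrow>
     uniformly_diff_at g 0 (hahn_interval q \<omega> a b) \<and>
     (\<forall>\<^sub>F \<epsilon> in nhds 0. hahn_integrable0 q \<omega> a (\<lambda>t. g t \<epsilon>) \<and> hahn_integrable0 q \<omega> b (\<lambda>t. g t \<epsilon>)) \<and>
     hahn_integrable0 q \<omega> a (\<lambda>t. deriv (g t) 0) \<and>
     hahn_integrable0 q \<omega> b (\<lambda>t. deriv (g t) 0)"

(* The coefficient of the i-th Hahn derivative in the Euler-Lagrange equation. *)
definition hahn_EL_coeff ::
  "real \<Rightarrow> real \<Rightarrow> real set \<Rightarrow> nat \<Rightarrow> (real \<Rightarrow> (nat \<Rightarrow> real) \<Rightarrow> real) \<Rightarrow> (real \<Rightarrow> real) \<Rightarrow>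
   nat \<Rightarrow> real \<Rightarrow> real" where
  "hahn_EL_coeff q \<omega> I r L y i = (\<lambda>\<tau>. partial i (L \<tau>) (hahn_shifted_jet q \<omega> I r y \<tau>))"

end

theory Submission
  imports Defs
begin

text \<open>Let \<open>x\<close> be an end point other than the fixed point \<open>\<omega>\<^sub>0\<close> of \<open>\<sigma>\<close>. The indicator of the single
  orbit point \<open>\<sigma>\<^sup>k\<^sup>+\<^sup>r(x)\<close> vanishes near \<open>\<omega>\<^sub>0\<close> and off one orbit, and it is a variation because its Hahn
  derivatives of order below \<open>r\<close> at \<open>x\<close> see only \<open>x, \<dots>, \<sigma>\<^sup>r\<^sup>-\<^sup>1(x)\<close>. It changes finitely many terms
  of the series for the functional, so the first variation is a finite sum and differentiation under
  the integral is elementary. Repeated summation by parts along the orbit, with \<open>D[f\<^sup>\<sigma>] = q D[f]\<^sup>\<sigma>\<close> giving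
  the powers of \<open>1/q\<close>, turns this sum into a nonzero multiple of the Euler-Lagrange expression at
  \<open>\<sigma>\<^sup>k(x)\<close>. The expression at \<open>\<omega>\<^sub>0\<close> is the limit of its values along the orbit.\<close>

section \<open>Differentiating along lines\<close>

text \<open>The topology on functions is the product topology, so limits are taken coordinate by
  coordinate. This is the mode of convergence in which continuity of the partial derivatives is
  exploited below.\<close>

lemma tendsto_fun_iff:
  fixes f :: "'a \<Rightarrow> 'b \<Rightarrow> 'c :: topological_space"
  shows "(f \<longlongrightarrow> l) F \<longleftrightarrow> (\<forall>i. ((\<lambda>x. f x i) \<longlongrightarrow> l i) F)"
  using limitin_componentwise[of "\<lambda>_. euclidean" UNIV f l F]
  by (simp add: euclidean_product_topology)

text \<open>Only coordinatewise derivatives are given, so the increment is telescoped: coordinates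
  move one at a time, each move is evaluated by the mean value theorem, and continuity of the
  partials sends the intermediate points back to \<open>u\<close>.\<close>

lemma C1_tuples_has_directional_derivative:
  assumes F: "C1_tuples n F" and u: "u \<in> real_tuples n" and v: "v \<in> real_tuples n"
  shows "((\<lambda>e. F (\<lambda>i. u i + e * v i)) has_field_derivative (\<Sum>j<n. partial j F u * v j)) (at 0)"
proof -
  have "((\<lambda>e. F (\<lambda>i. if i < m then u i + e * v i else u i)) has_field_derivative
      (\<Sum>j<m. partial j F u * v j)) (at 0)" if "m \<le> n" for m
    using that
  proof (induction m)
    case 0
    then show ?case by simp
  next
    case (Suc m)
    \<comment> \<open>Coordinates below \<open>m\<close> have already moved, coordinate
      \<open>m\<close> is free, later ones are still at \<open>u\<close>.\<close>
    define w where "w e x = (\<lambda>i. if i < m then u i + e * v i else if i = m then x else u i)" for e x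
    have w_tuple: "w e x \<in> real_tuples n" for e x
      using u v Suc.prems by (auto simp: real_tuples_def w_def)
    have w_upd: "(w e x)(m := y) = w e y" for e x y
      by (auto simp: w_def)
    have dF: "((\<lambda>y. F (w e y)) has_field_derivative partial m F (w e x)) (at x)" for e x
    proof -
      have "(\<lambda>y. F ((w e x)(m := y))) field_differentiable (at ((w e x) m))"
        using F w_tuple Suc.prems by (auto simp: C1_tuples_def)
      then show ?thesis
        unfolding partial_def w_upd by (auto simp: w_def field_differentiable_derivI)
    qed
    \<comment> \<open>The mean value theorem is applied in a parameter on [0, 1], so that the sign
      or vanishing of \<open>e * v m\<close> does not matter.\<close>
    have "\<exists>z. 0 < z \<and> z < 1 \<and>
        F (w e (u m + e * v m)) - F (w e (u m)) = e * v m * partial m F (w e (u m + z * (e * v m)))" for e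
    proof -
      have "((\<lambda>s. F (w e (u m + s * (e * v m)))) has_field_derivative
          partial m F (w e (u m + s * (e * v m))) * (e * v m)) (at s)" for s
        by (rule DERIV_chain2[OF dF]) (auto intro!: derivative_eq_intros)
      then obtain z where "0 < z" "z < 1"
        "F (w e (u m + 1 * (e * v m))) - F (w e (u m + 0 * (e * v m))) =
          (1 - 0) * (partial m F (w e (u m + z * (e * v m))) * (e * v m))"
        using MVT2[of 0 1 "\<lambda>s. F (w e (u m + s * (e * v m)))"
            "\<lambda>s. partial m F (w e (u m + s * (e * v m))) * (e * v m)"] by auto
      then show ?thesis by (intro exI[of _ z]) (auto simp: mult_ac)
    qed
    then obtain z where z: "\<And>e. 0 < z e" "\<And>e. z e < 1"
      and mvt: "\<And>e. F (w e (u m + e * v m)) - F (w e (u m)) =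
        e * v m * partial m F (w e (u m + z e * (e * v m)))"
      by metis
    have w0: "w 0 (u m) = u"
      by (auto simp: w_def)
    \<comment> \<open>The choice \<open>z\<close> has no known continuity; its bounds and the factor
      \<open>e\<close> suffice.\<close>
    have "((\<lambda>e. z e * (e * v m)) \<longlongrightarrow> 0) (at 0)"
    proof (rule Lim_null_comparison)
      show "\<forall>\<^sub>F e in at 0. norm (z e * (e * v m)) \<le> \<bar>e * v m\<bar>"
        using z by (auto simp: abs_mult less_imp_le intro!: always_eventually mult_left_le_one_le)
      show "((\<lambda>e. \<bar>e * v m\<bar>) \<longlongrightarrow> 0) (at 0)"
        by (auto intro!: tendsto_eq_intros)
    qed
    then have "((\<lambda>e. u m + z e * (e * v m)) \<longlongrightarrow> u m) (at 0)"
      using tendsto_add[OF tendsto_const[of "u m"]] by fastforce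
    then have "((\<lambda>e. w e (u m + z e * (e * v m))) \<longlongrightarrow> u) (at 0)"
    proof (unfold tendsto_fun_iff, intro allI)
      fix i
      assume lim: "((\<lambda>e. u m + z e * (e * v m)) \<longlongrightarrow> u m) (at 0)"
      have "((\<lambda>e. u i + e * v i) \<longlongrightarrow> u i) (at 0)"
        by (auto intro!: tendsto_eq_intros)
      with lim show "((\<lambda>e. w e (u m + z e * (e * v m)) i) \<longlongrightarrow> u i) (at 0)"
        by (cases i m rule: linorder_cases) (simp_all add: w_def)
    qed
    then have "((\<lambda>e. partial m F (w e (u m + z e * (e * v m)))) \<longlongrightarrow> partial m F u) (at 0)"
      using F u w_tuple Suc.prems
      by (intro continuous_on_tendsto_compose[of "real_tuples n" "partial m F"])
        (auto simp: C1_tuples_def)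
    then have lim: "((\<lambda>e. v m * partial m F (w e (u m + z e * (e * v m)))) \<longlongrightarrow> v m * partial m F u) (at 0)"
      by (intro tendsto_mult_left)
    \<comment> \<open>The difference vanishes at \<open>e = 0\<close>, so by \<open>mvt\<close> its
      quotient by \<open>e\<close> is exactly the expression whose limit is
      \<open>lim\<close>.\<close>
    have "((\<lambda>e. F (w e (u m + e * v m)) - F (w e (u m))) has_field_derivative v m * partial m F u) (at 0)"
      unfolding DERIV_def
      by (rule Lim_transform_eventually[OF lim])
        (auto simp: mvt eventually_at_filter)
    from DERIV_add[OF Suc.IH[OF Suc_leD[OF Suc.prems]] this]
    have "((\<lambda>e. F (\<lambda>i. if i < m then u i + e * v i else u i) +
        (F (w e (u m + e * v m)) - F (w e (u m)))) has_field_derivative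
        (\<Sum>j<Suc m. partial j F u * v j)) (at 0)"
      by (simp add: mult.commute)
    moreover have "F (\<lambda>i. if i < m then u i + e * v i else u i) +
        (F (w e (u m + e * v m)) - F (w e (u m))) =
        F (\<lambda>i. if i < Suc m then u i + e * v i else u i)" for e
    proof -
      have "w e (u m) = (\<lambda>i. if i < m then u i + e * v i else u i)"
        "w e (u m + e * v m) = (\<lambda>i. if i < Suc m then u i + e * v i else u i)"
        by (auto simp: w_def less_Suc_eq)
      then show ?thesis by simp
    qed
    ultimately show ?case by simp
  qed
  from this[OF order_refl]
  have "((\<lambda>e. F (\<lambda>i. if i < n then u i + e * v i else u i)) has_field_derivative
      (\<Sum>j<n. partial j F u * v j)) (at 0)" .
  moreover have "(\<lambda>i. if i < n then u i + e * v i else u i) = (\<lambda>i. u i + e * v i)" for e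
    using v by (auto simp: real_tuples_def)
  ultimately show ?thesis by simp
qed

section \<open>Difference quotients of sequences on a geometric grid\<close>

text \<open>The Hahn derivative read along an orbit: with \<open>d\<close> the distance of the start
  from the fixed point, signed, the \<open>k\<close>-th point lies at offset
  \<open>q ^ k * d\<close>, and the denominator is the step to the next point.\<close>

definition qdiff :: "real \<Rightarrow> real \<Rightarrow> (nat \<Rightarrow> real) \<Rightarrow> nat \<Rightarrow> real" where
  "qdiff q d x k = (x (Suc k) - x k) / ((q - 1) * q ^ k * d)"

lemma qdiff_power_lincomb:
  "(qdiff q d ^^ i) (\<lambda>k. x k + e * y k) k = (qdiff q d ^^ i) x k + e * (qdiff q d ^^ i) y k"
proof (induction i arbitrary: k)
  case 0
  then show ?case by simp
next
  case (Suc i)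
  have "(a + e * b - (a' + e * b')) / c = (a - a') / c + e * ((b - b') / c)" for a a' b b' c :: real
    by (simp add: add_divide_distrib diff_divide_distrib right_diff_distrib)
  then show ?case by (simp add: qdiff_def[of _ _ "(_ ^^ _) _"] Suc.IH)
qed

lemma qdiff_power_eq_0:
  assumes "\<And>j. k \<le> j \<Longrightarrow> j \<le> k + i \<Longrightarrow> x j = 0"
  shows "(qdiff q d ^^ i) x k = 0"
  using assms by (induction i arbitrary: k) (simp_all add: qdiff_def)

text \<open>The sequence form of D[f o \<sigma>] = q (D[f] o \<sigma>): the step at index
  \<open>Suc k\<close> is \<open>q\<close> times the step at \<open>k\<close>, so each difference
  costs one factor \<open>1 / q\<close>.\<close>

lemma qdiff_power_Suc_shift:
  shows "(qdiff q d ^^ i) x (Suc k) = (1 / q) ^ i * (qdiff q d ^^ i) (\<lambda>k. x (Suc k)) k"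
proof (induction i arbitrary: k)
  case 0
  then show ?case by simp
next
  case (Suc i)
  have "(c * a - c * b) / ((q - 1) * q ^ Suc k * d) = 1 / q * c * ((a - b) / ((q - 1) * q ^ k * d))"
    for a b c :: real
    by (simp add: field_simps)
  from this[of "(1 / q) ^ i"] show ?case
    by (simp only: funpow.simps o_apply qdiff_def[of _ _ "(_ ^^ _) _"] Suc.IH power_Suc)
qed

text \<open>The weight \<open>q ^ k\<close> cancels the one in the step, so the product rule D[fg] =
  f D[g] + D[f] (g o \<sigma>) sums to a telescoping series, whose boundary terms vanish with
  \<open>g\<close>.\<close>

lemma sum_qdiff_by_parts:
  assumes q: "q \<noteq> 0" "q \<noteq> 1" and d: "d \<noteq> 0" and "g 0 = 0" "g N = 0"
  shows "(\<Sum>k<N. q ^ k * f k * qdiff q d g k) = - (\<Sum>k<N. q ^ k * qdiff q d f k * g (Suc k))"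
proof -
  have "(\<Sum>k<N. q ^ k * f k * qdiff q d g k) + (\<Sum>k<N. q ^ k * qdiff q d f k * g (Suc k)) =
      (\<Sum>k<N. (f (Suc k) * g (Suc k) - f k * g k) / ((q - 1) * d))"
  proof (unfold sum.distrib[symmetric], intro sum.cong refl)
    fix k
    have cancel: "q ^ k * u * (z / ((q - 1) * q ^ k * d)) = u * z / ((q - 1) * d)"
      "q ^ k * (z / ((q - 1) * q ^ k * d)) * u = z * u / ((q - 1) * d)" for u z
      using q(1) by simp_all
    show "q ^ k * f k * qdiff q d g k + q ^ k * qdiff q d f k * g (Suc k) =
        (f (Suc k) * g (Suc k) - f k * g k) / ((q - 1) * d)"
      unfolding qdiff_def cancel by (simp add: add_divide_distrib[symmetric] algebra_simps)
  qed
  also have "\<dots> = 0"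
    using assms by (simp add: sum_divide_distrib[symmetric] sum_lessThan_telescope[of "\<lambda>k. f k * g k"])
  finally show ?thesis by simp
qed

text \<open>Each summation by parts shifts \<open>h\<close> once, and moving that shift past the
  differences still acting on \<open>h\<close> costs one \<open>1 / q\<close> apiece; the exponents
  0, ..., i - 1 add up to the triangular number. The zeros of \<open>h\<close> at both ends kill the
  boundary terms at every stage.\<close>

lemma sum_qdiff_power_by_parts:
  assumes q: "q \<noteq> 0" "q \<noteq> 1" and d: "d \<noteq> 0"
    and "\<And>j. j < i \<Longrightarrow> h j = 0" and "\<And>j. N \<le> j \<Longrightarrow> h j = 0"
  shows "(\<Sum>k<N. q ^ k * f k * (qdiff q d ^^ i) h k) =
    (- 1) ^ i * (1 / q) ^ ((i - 1) * i div 2) * (\<Sum>k<N. q ^ k * (qdiff q d ^^ i) f k * h (k + i))"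
  using assms(4,5)
proof (induction i arbitrary: f h)
  case 0
  then show ?case by simp
next
  case (Suc i)
  \<comment> \<open>Since (i + 1) i = 2 i + (i - 1) i, the division splits; the truncated
    \<open>i - 1\<close> at \<open>i = 0\<close> is harmless because it is multiplied by 0.\<close>
  have exponent: "(Suc i - 1) * Suc i div 2 = i + (i - 1) * i div 2"
    by (cases i) (auto simp: algebra_simps)
  have "(\<Sum>k<N. q ^ k * f k * (qdiff q d ^^ Suc i) h k) =
      (\<Sum>k<N. q ^ k * f k * qdiff q d ((qdiff q d ^^ i) h) k)"
    by simp
  also have "\<dots> = - (\<Sum>k<N. q ^ k * qdiff q d f k * (qdiff q d ^^ i) h (Suc k))"
    using Suc.prems q d by (intro sum_qdiff_by_parts) (auto intro!: qdiff_power_eq_0)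
  also have "\<dots> = - ((1 / q) ^ i) * (\<Sum>k<N. q ^ k * qdiff q d f k * (qdiff q d ^^ i) (\<lambda>k. h (Suc k)) k)"
    by (simp add: qdiff_power_Suc_shift sum_distrib_left sum_negf mult.left_commute)
  also have "(\<Sum>k<N. q ^ k * qdiff q d f k * (qdiff q d ^^ i) (\<lambda>k. h (Suc k)) k) =
      (- 1) ^ i * (1 / q) ^ ((i - 1) * i div 2) *
        (\<Sum>k<N. q ^ k * (qdiff q d ^^ i) (qdiff q d f) k * h (Suc (k + i)))"
    using Suc.prems by (intro Suc.IH) auto
  finally show ?case
    by (simp only: exponent power_add funpow_Suc_right o_apply) simp
qed

section \<open>Hahn derivatives along orbits\<close>

lemma hahn_sigma_funpow:
  assumes "q \<noteq> 1"
  shows "(hahn_sigma q \<omega> ^^ k) x = hahn_omega0 q \<omega> + q ^ k * (x - hahn_omega0 q \<omega>)"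
proof -
  have "hahn_omega0 q \<omega> = q * hahn_omega0 q \<omega> + \<omega>"
    using assms by (simp add: hahn_omega0_def divide_simps) (simp add: algebra_simps)
  note fixed = this
  show ?thesis
  proof (induction k)
    case (Suc k)
    then show ?case
      using fixed by (simp add: hahn_sigma_def distrib_left)
  qed simp
qed

lemma orbit_point_eq_funpow:
  assumes "q \<noteq> 1"
  shows "q ^ k * x + \<omega> * q_bracket q k = (hahn_sigma q \<omega> ^^ k) x"
  unfolding hahn_sigma_funpow[OF assms] hahn_omega0_def q_bracket_def
  by (simp add: algebra_simps diff_divide_distrib)

lemma hahn_orbit_eq: "q \<noteq> 1 \<Longrightarrow> hahn_orbit q \<omega> x = range (\<lambda>n. (hahn_sigma q \<omega> ^^ n) x)"
  by (auto simp: hahn_orbit_def orbit_point_eq_funpow)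

lemma hahn_sigma_funpow_LIMSEQ:
  assumes "0 < q" "q < 1"
  shows "(\<lambda>n. (hahn_sigma q \<omega> ^^ n) x) \<longlonglongrightarrow> hahn_omega0 q \<omega>"
  using assms by (auto simp: hahn_sigma_funpow intro!: tendsto_eq_intros LIMSEQ_power_zero)

lemma hahn_sigma_funpow_eq_iff:
  assumes "0 < q" "q < 1"
  shows "(hahn_sigma q \<omega> ^^ n) x = (hahn_sigma q \<omega> ^^ n) y \<longleftrightarrow> x = y"
  using assms by (auto simp: hahn_sigma_funpow)

lemma hahn_sigma_funpow_eq_omega0_iff:
  assumes "0 < q" "q < 1"
  shows "(hahn_sigma q \<omega> ^^ n) x = hahn_omega0 q \<omega> \<longleftrightarrow> x = hahn_omega0 q \<omega>"
  using assms by (auto simp: hahn_sigma_funpow)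

lemma inj_hahn_sigma_funpow:
  assumes "0 < q" "q < 1" "x \<noteq> hahn_omega0 q \<omega>"
  shows "(hahn_sigma q \<omega> ^^ n) x = (hahn_sigma q \<omega> ^^ m) x \<longleftrightarrow> n = m"
proof -
  have "q ^ n \<noteq> q ^ m" if "n \<noteq> m"
    using assms that
    by (cases n m rule: linorder_cases)
      (auto dest: power_strict_decreasing[of n m q] power_strict_decreasing[of m n q])
  then show ?thesis
    using assms by (auto simp: hahn_sigma_funpow)
qed

text \<open>\<sigma> is injective, so a common point could be pulled back by the smaller number of
  iterations, which would place one starting point on the orbit of the other.\<close>

lemma hahn_orbits_disjoint:
  assumes q: "0 < q" "q < 1" and "x \<notin> hahn_orbit q \<omega> y" "y \<notin> hahn_orbit q \<omega> x"
  shows "(hahn_sigma q \<omega> ^^ m) x \<noteq> (hahn_sigma q \<omega> ^^ n) y"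
proof
  assume eq: "(hahn_sigma q \<omega> ^^ m) x = (hahn_sigma q \<omega> ^^ n) y"
  show False
  proof (cases "m \<le> n")
    case True
    then have "(hahn_sigma q \<omega> ^^ m) x = (hahn_sigma q \<omega> ^^ m) ((hahn_sigma q \<omega> ^^ (n - m)) y)"
      using eq funpow_add[of m "n - m" "hahn_sigma q \<omega>"] by simp
    then show False
      using assms by (auto simp: hahn_sigma_funpow_eq_iff hahn_orbit_eq)
  next
    case False
    then have "(hahn_sigma q \<omega> ^^ n) y = (hahn_sigma q \<omega> ^^ n) ((hahn_sigma q \<omega> ^^ (m - n)) x)"
      using eq funpow_add[of n "m - n" "hahn_sigma q \<omega>"] by simp
    then show False
      using assms by (auto simp: hahn_sigma_funpow_eq_iff hahn_orbit_eq)
  qed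
qed

text \<open>Iterates are convex combinations of \<open>x\<close> and the fixed point.\<close>

lemma hahn_sigma_funpow_mem_interval:
  assumes q: "0 < q" "q < 1" and I: "is_interval I" "hahn_omega0 q \<omega> \<in> I" "x \<in> I"
  shows "(hahn_sigma q \<omega> ^^ n) x \<in> I"
proof -
  have "(1 - q ^ n) *\<^sub>R hahn_omega0 q \<omega> + q ^ n *\<^sub>R x \<in> I"
    using I q by (intro convexD_alt is_interval_convex) (auto simp: power_le_one)
  then show ?thesis
    using q by (simp add: hahn_sigma_funpow algebra_simps)
qed

lemma hahn_deriv_off_omega0:
  assumes "q \<noteq> 1" "t \<noteq> hahn_omega0 q \<omega>"
  shows "hahn_deriv q \<omega> I f t = (f (hahn_sigma q \<omega> t) - f t) / ((q - 1) * (t - hahn_omega0 q \<omega>))"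
proof -
  have "(q - 1) * t + \<omega> = (q - 1) * (t - hahn_omega0 q \<omega>)"
    using assms by (simp add: hahn_omega0_def field_simps)
  then show ?thesis
    using assms by (simp add: hahn_deriv_def hahn_sigma_def)
qed

lemma hahn_derivs_Suc: "hahn_derivs q \<omega> I (Suc i) f = hahn_deriv q \<omega> I (hahn_derivs q \<omega> I i f)"
  by (simp add: hahn_derivs_def)

text \<open>An orbit starting off the fixed point never reaches it, so only the difference quotient
  branch occurs and Hahn derivatives of any function reduce to differences of its values on the
  orbit.\<close>

lemma hahn_derivs_orbit:
  assumes q: "0 < q" "q < 1" and "x \<noteq> hahn_omega0 q \<omega>"
  shows "hahn_derivs q \<omega> I i f ((hahn_sigma q \<omega> ^^ k) x) =
    (qdiff q (x - hahn_omega0 q \<omega>) ^^ i) (\<lambda>k. f ((hahn_sigma q \<omega> ^^ k) x)) k"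
proof (induction i arbitrary: k)
  case 0
  then show ?case by (simp add: hahn_derivs_def)
next
  case (Suc i)
  have "hahn_sigma q \<omega> ((hahn_sigma q \<omega> ^^ k) x) = (hahn_sigma q \<omega> ^^ Suc k) x"
    by simp
  moreover have "(hahn_sigma q \<omega> ^^ k) x - hahn_omega0 q \<omega> = q ^ k * (x - hahn_omega0 q \<omega>)"
    using q by (simp add: hahn_sigma_funpow)
  ultimately show ?case
    using assms hahn_sigma_funpow_eq_omega0_iff[of q k \<omega> x] Suc.IH[of k] Suc.IH[of "Suc k"]
    by (simp add: hahn_derivs_Suc hahn_deriv_off_omega0 qdiff_def mult.assoc)
qed

lemma hahn_shifted_jet_orbit:
  assumes "0 < q" "q < 1" and "x \<noteq> hahn_omega0 q \<omega>" and "i \<le> r"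
  shows "hahn_shifted_jet q \<omega> I r y ((hahn_sigma q \<omega> ^^ k) x) i =
    (qdiff q (x - hahn_omega0 q \<omega>) ^^ i) (\<lambda>k. y ((hahn_sigma q \<omega> ^^ (r - i + k)) x)) k"
  using assms by (simp add: hahn_shifted_jet_def hahn_derivs_orbit hahn_shift_def funpow_add del: add_diff_assoc2)

lemma hahn_shifted_jet_mem_real_tuples: "hahn_shifted_jet q \<omega> I r y t \<in> real_tuples (Suc r)"
  by (simp add: hahn_shifted_jet_def real_tuples_def)

lemma hahn_shifted_jet_lincomb_orbit:
  assumes "0 < q" "q < 1" and "x \<noteq> hahn_omega0 q \<omega>"
  shows "hahn_shifted_jet q \<omega> I r (\<lambda>t. y t + e * z t) ((hahn_sigma q \<omega> ^^ k) x) =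
    (\<lambda>i. hahn_shifted_jet q \<omega> I r y ((hahn_sigma q \<omega> ^^ k) x) i +
      e * hahn_shifted_jet q \<omega> I r z ((hahn_sigma q \<omega> ^^ k) x) i)" (is "?l = ?r")
proof
  fix i
  show "?l i = ?r i"
  proof (cases "i \<le> r")
    case True
    then show ?thesis using assms by (simp add: hahn_shifted_jet_orbit qdiff_power_lincomb)
  next
    case False
    then show ?thesis by (simp add: hahn_shifted_jet_def)
  qed
qed

section \<open>The function spaces\<close>

text \<open>Nontriviality of this filter makes the derivative within \<open>I\<close> at the fixed
  point unique.\<close>

lemma at_within_interval_neq_bot:
  fixes I :: "real set"
  assumes "is_interval I" "w \<in> I" "x \<in> I" "x \<noteq> w"
  shows "at w within I \<noteq> bot"
proof -
  have "connected I"
    using assms by (simp add: is_interval_connected)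
  then show ?thesis
    using assms connected_imp_perfect[of I w] by (auto simp: trivial_limit_within)
qed

text \<open>\<sigma> contracts towards the centre and so maps the ball into itself; at the centre
  the derivative of a locally zero function is 0.\<close>

lemma hahn_derivs_eq_0_ball:
  assumes q: "0 < q" "q < 1" and nbot: "at (hahn_omega0 q \<omega>) within I \<noteq> bot"
    and f: "\<And>t. t \<in> ball (hahn_omega0 q \<omega>) \<rho> \<Longrightarrow> f t = 0"
    and t: "t \<in> ball (hahn_omega0 q \<omega>) \<rho>"
  shows "hahn_derivs q \<omega> I i f t = 0"
  using t
proof (induction i arbitrary: t)
  case 0
  then show ?case using f by (simp add: hahn_derivs_def)
next
  case (Suc i)
  show ?case
  proof (cases "t = hahn_omega0 q \<omega>")
    case True
    have "(hahn_derivs q \<omega> I i f has_vector_derivative 0) (at t)"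
      by (rule has_vector_derivative_transform_within_open[OF has_vector_derivative_const[where c = 0],
          where S = "ball (hahn_omega0 q \<omega>) \<rho>"])
        (use Suc in auto)
    then show ?thesis
      using nbot True
      by (auto simp: hahn_derivs_Suc hahn_deriv_def has_vector_derivative_at_within
          intro!: vector_derivative_within)
  next
    case False
    have "\<bar>q * (t - hahn_omega0 q \<omega>)\<bar> \<le> \<bar>t - hahn_omega0 q \<omega>\<bar>"
      using q by (simp add: abs_mult mult_left_le_one_le)
    then have "hahn_sigma q \<omega> t \<in> ball (hahn_omega0 q \<omega>) \<rho>"
      using Suc.prems q hahn_sigma_funpow[of q 1 \<omega> t] by (auto simp: dist_real_def)
    then show ?thesis
      using False q Suc by (simp add: hahn_derivs_Suc hahn_deriv_off_omega0)
  qed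
qed

lemma hahn_derivs_zero_fun:
  assumes "0 < q" "q < 1" "at (hahn_omega0 q \<omega>) within I \<noteq> bot"
  shows "hahn_derivs q \<omega> I i (\<lambda>_. 0) t = 0"
  using assms by (rule hahn_derivs_eq_0_ball[of _ _ _ "dist (hahn_omega0 q \<omega>) t + 1"]) auto

text \<open>Both orbits converge to the fixed point. For a function vanishing near it, boundedness
  on the grid thus concerns finitely many values.\<close>

lemma finite_hahn_interval_minus_ball:
  assumes q: "0 < q" "q < 1" and "0 < \<rho>"
  shows "finite (hahn_interval q \<omega> a b - ball (hahn_omega0 q \<omega>) \<rho>)"
proof -
  have "finite (hahn_orbit q \<omega> x - ball (hahn_omega0 q \<omega>) \<rho>)" for x
  proof -
    obtain N where "\<forall>n\<ge>N. dist ((hahn_sigma q \<omega> ^^ n) x) (hahn_omega0 q \<omega>) < \<rho>"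
      using hahn_sigma_funpow_LIMSEQ[OF q] \<open>0 < \<rho>\<close> unfolding lim_sequentially by blast
    then have "hahn_orbit q \<omega> x - ball (hahn_omega0 q \<omega>) \<rho> \<subseteq> (\<lambda>n. (hahn_sigma q \<omega> ^^ n) x) ` {..<N}"
      using q by (auto simp: hahn_orbit_eq dist_commute image_iff) (metis not_le lessThan_iff)
    then show ?thesis by (rule finite_subset) simp
  qed
  moreover have "hahn_interval q \<omega> a b - ball (hahn_omega0 q \<omega>) \<rho> \<subseteq>
      (hahn_orbit q \<omega> a - ball (hahn_omega0 q \<omega>) \<rho>) \<union> (hahn_orbit q \<omega> b - ball (hahn_omega0 q \<omega>) \<rho>)"
    using \<open>0 < \<rho>\<close> by (auto simp: hahn_interval_def)
  ultimately show ?thesis by (meson finite_Un finite_subset)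
qed

lemma vanishing_near_omega0_mem_hahn_Y:
  assumes q: "0 < q" "q < 1" and nbot: "at (hahn_omega0 q \<omega>) within I \<noteq> bot" and "0 < \<rho>"
    and f: "\<And>t. t \<in> ball (hahn_omega0 q \<omega>) \<rho> \<Longrightarrow> f t = 0"
  shows "f \<in> hahn_Y q \<omega> I a b r"
proof -
  let ?B = "ball (hahn_omega0 q \<omega>) \<rho>" and ?D = "\<lambda>i. hahn_derivs q \<omega> I i f"
  have zero: "?D i t = 0" if "t \<in> ?B" for i t
    using hahn_derivs_eq_0_ball[OF q nbot, of \<rho> f] f that by blast
  have diff: "?D i differentiable (at (hahn_omega0 q \<omega>) within I)" for i
  proof -
    have "(?D i has_vector_derivative 0) (at (hahn_omega0 q \<omega>))"
      by (rule has_vector_derivative_transform_within_open[OF has_vector_derivative_const[where c = 0], where S = ?B])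
        (use zero \<open>0 < \<rho>\<close> in auto)
    then show ?thesis
      using has_vector_derivative_at_within differentiableI_vector by blast
  qed
  have "bounded (?D i ` hahn_interval q \<omega> a b)" for i
  proof -
    have "?D i ` hahn_interval q \<omega> a b \<subseteq> insert 0 (?D i ` (hahn_interval q \<omega> a b - ?B))"
      using zero by auto
    then show ?thesis
      using finite_hahn_interval_minus_ball[OF q \<open>0 < \<rho>\<close>]
      by (meson finite_imp_bounded finite_imageI finite_insert finite_subset)
  qed
  then show ?thesis
    using diff differentiable_imp_continuous_within[OF diff] by (auto simp: hahn_Y_def)
qed

text \<open>Off the fixed point linearity is algebra; at the fixed point it rests on
  differentiability of the lower orders, supplied by membership in \<open>hahn_Y\<close>.\<close>

lemma hahn_derivs_lincomb:
  assumes nbot: "at (hahn_omega0 q \<omega>) within I \<noteq> bot"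
    and f: "f \<in> hahn_Y q \<omega> I a b r" and g: "g \<in> hahn_Y q \<omega> I a b r" and "i \<le> r"
  shows "hahn_derivs q \<omega> I i (\<lambda>t. f t + e * g t) =
    (\<lambda>t. hahn_derivs q \<omega> I i f t + e * hahn_derivs q \<omega> I i g t)"
  using \<open>i \<le> r\<close>
proof (induction i)
  case 0
  then show ?case by (simp add: hahn_derivs_def)
next
  case (Suc i)
  let ?F = "at (hahn_omega0 q \<omega>) within I"
  let ?f = "hahn_derivs q \<omega> I i f" and ?g = "hahn_derivs q \<omega> I i g"
  have "(?f has_vector_derivative vector_derivative ?f ?F) ?F"
    "(?g has_vector_derivative vector_derivative ?g ?F) ?F"
    using f g Suc.prems nbot by (auto simp: hahn_Y_def vector_derivative_works[symmetric])
  then have "((\<lambda>t. ?f t + e * ?g t) has_vector_derivative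
      vector_derivative ?f ?F + e * vector_derivative ?g ?F) ?F"
    by (intro has_vector_derivative_add has_vector_derivative_mult_right)
  then have "vector_derivative (\<lambda>t. ?f t + e * ?g t) ?F =
      vector_derivative ?f ?F + e * vector_derivative ?g ?F"
    using nbot by (rule vector_derivative_within[rotated])
  then show ?case
    using Suc.IH Suc.prems
    by (intro ext) (simp add: hahn_derivs_Suc hahn_deriv_def
        add_divide_distrib diff_divide_distrib right_diff_distrib)
qed

lemma hahn_Y_lincomb:
  assumes nbot: "at (hahn_omega0 q \<omega>) within I \<noteq> bot"
    and f: "f \<in> hahn_Y q \<omega> I a b r" and g: "g \<in> hahn_Y q \<omega> I a b r"
  shows "(\<lambda>t. f t + e * g t) \<in> hahn_Y q \<omega> I a b r"
proof -
  have "bounded ((\<lambda>t. hahn_derivs q \<omega> I i f t + e * hahn_derivs q \<omega> I i g t) ` hahn_interval q \<omega> a b)"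
    if "i \<le> r" for i
  proof (rule bounded_plus_comp)
    show "bounded (hahn_derivs q \<omega> I i f ` hahn_interval q \<omega> a b)"
      using f that by (simp add: hahn_Y_def)
    have "bounded (hahn_derivs q \<omega> I i g ` hahn_interval q \<omega> a b)"
      using g that by (simp add: hahn_Y_def)
    from bounded_scaling[OF this, of e]
    show "bounded ((\<lambda>t. e * hahn_derivs q \<omega> I i g t) ` hahn_interval q \<omega> a b)"
      by (simp add: image_image)
  qed
  then show ?thesis
    using f g
    by (auto simp: hahn_Y_def hahn_derivs_lincomb[OF nbot f g] intro!: derivative_intros continuous_intros)
qed

lemma hahn_norm_scale_le:
  assumes q: "0 < q" "q < 1" and nbot: "at (hahn_omega0 q \<omega>) within I \<noteq> bot"
    and g: "g \<in> hahn_Y q \<omega> I a b r"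
  shows "hahn_norm q \<omega> I a b r (\<lambda>t. e * g t) \<le> \<bar>e\<bar> * hahn_norm q \<omega> I a b r g"
proof -
  \<comment> \<open>Scaling is obtained from linearity by writing \<open>e * g t\<close> as
    \<open>0 + e * g t\<close>.\<close>
  have 0: "(\<lambda>_. 0) \<in> hahn_Y q \<omega> I a b r"
    by (rule vanishing_near_omega0_mem_hahn_Y[OF q nbot, of 1]) auto
  have D: "hahn_derivs q \<omega> I i (\<lambda>t. e * g t) t = e * hahn_derivs q \<omega> I i g t" if "i \<le> r" for i t
    using hahn_derivs_lincomb[OF nbot 0 g that, of e]
      hahn_derivs_zero_fun[OF q nbot]
    by simp
  have "(SUP t\<in>hahn_interval q \<omega> a b. \<bar>hahn_derivs q \<omega> I i (\<lambda>t. e * g t) t\<bar>) \<le>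
      \<bar>e\<bar> * (SUP t\<in>hahn_interval q \<omega> a b. \<bar>hahn_derivs q \<omega> I i g t\<bar>)" if "i \<le> r" for i
  proof (rule cSUP_least)
    show "hahn_interval q \<omega> a b \<noteq> {}" by (simp add: hahn_interval_def)
    have "bounded (hahn_derivs q \<omega> I i g ` hahn_interval q \<omega> a b)"
      using g that by (simp add: hahn_Y_def)
    then have "bdd_above ((\<lambda>t. \<bar>hahn_derivs q \<omega> I i g t\<bar>) ` hahn_interval q \<omega> a b)"
      by (auto simp: bounded_iff bdd_above_def)
    then show "\<bar>hahn_derivs q \<omega> I i (\<lambda>t. e * g t) t\<bar> \<le>
      \<bar>e\<bar> * (SUP t\<in>hahn_interval q \<omega> a b. \<bar>hahn_derivs q \<omega> I i g t\<bar>)"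
      if "t \<in> hahn_interval q \<omega> a b" for t
      using that \<open>i \<le> r\<close> by (auto simp: D abs_mult intro!: mult_left_mono cSUP_upper2[of _ _ t])
  qed
  then show ?thesis
    by (auto simp: hahn_norm_def sum_distrib_left intro!: sum_mono)
qed

section \<open>The first variation\<close>

text \<open>The end point whose orbit the variation misses contributes a constant. If it is the
  fixed point, the factor before the series is 0; otherwise the shifted jet of \<eta> vanishes along
  the orbit.\<close>

lemma hahn_integral0_variation_eq:
  assumes q: "0 < q" "q < 1" and "\<And>j. \<eta> ((hahn_sigma q \<omega> ^^ j) x) = 0"
  shows "hahn_integral0 q \<omega> x (\<lambda>t. L t (hahn_shifted_jet q \<omega> I r (\<lambda>t. y t + e * \<eta> t) t)) =
    hahn_integral0 q \<omega> x (\<lambda>t. L t (hahn_shifted_jet q \<omega> I r y t))"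
proof (cases "x = hahn_omega0 q \<omega>")
  case True
  then have "x * (1 - q) - \<omega> = 0"
    using q by (simp add: hahn_omega0_def)
  then show ?thesis
    by (simp add: hahn_integral0_def)
next
  case False
  have "hahn_shifted_jet q \<omega> I r \<eta> ((hahn_sigma q \<omega> ^^ k) x) i = 0" for k i
    using assms False
    by (cases "i \<le> r") (simp_all add: hahn_shifted_jet_orbit qdiff_power_eq_0, simp add: hahn_shifted_jet_def)
  then show ?thesis
    using q False by (simp add: hahn_integral0_def orbit_point_eq_funpow hahn_shifted_jet_lincomb_orbit)
qed

text \<open>The jet of \<eta> vanishes from index \<open>N\<close> on, so the varied series is the
  original convergent one plus a finite sum.\<close>

lemma hahn_integral0_finite_variation:
  assumes q: "0 < q" "q < 1" and x: "x \<noteq> hahn_omega0 q \<omega>"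
    and \<eta>: "\<And>j. N \<le> j \<Longrightarrow> \<eta> ((hahn_sigma q \<omega> ^^ j) x) = 0"
    and y: "hahn_integrable0 q \<omega> x (\<lambda>t. L t (hahn_shifted_jet q \<omega> I r y t))"
  shows "hahn_integral0 q \<omega> x (\<lambda>t. L t (hahn_shifted_jet q \<omega> I r (\<lambda>t. y t + e * \<eta> t) t)) =
    hahn_integral0 q \<omega> x (\<lambda>t. L t (hahn_shifted_jet q \<omega> I r y t)) +
    (x * (1 - q) - \<omega>) * (\<Sum>k<N. q ^ k *
      (L ((hahn_sigma q \<omega> ^^ k) x) (\<lambda>i. hahn_shifted_jet q \<omega> I r y ((hahn_sigma q \<omega> ^^ k) x) i +
          e * hahn_shifted_jet q \<omega> I r \<eta> ((hahn_sigma q \<omega> ^^ k) x) i) -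
       L ((hahn_sigma q \<omega> ^^ k) x) (hahn_shifted_jet q \<omega> I r y ((hahn_sigma q \<omega> ^^ k) x))))"
    (is "_ = _ + _ * (\<Sum>k<N. q ^ k * (?A k - ?B k))")
proof -
  have "hahn_shifted_jet q \<omega> I r \<eta> ((hahn_sigma q \<omega> ^^ k) x) i = 0" if "N \<le> k" for k i
    using assms that
    by (cases "i \<le> r") (simp_all add: hahn_shifted_jet_orbit qdiff_power_eq_0, simp add: hahn_shifted_jet_def)
  then have "?A k = ?B k" if "N \<le> k" for k
    using that by simp
  then have "(\<lambda>k. q ^ k * (?A k - ?B k)) sums (\<Sum>k<N. q ^ k * (?A k - ?B k))"
    by (intro sums_finite) auto
  moreover have "(\<lambda>k. q ^ k * ?B k) sums (\<Sum>k. q ^ k * ?B k)"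
    using y q by (simp add: hahn_integrable0_def orbit_point_eq_funpow summable_sums)
  ultimately have "(\<lambda>k. q ^ k * ?B k + q ^ k * (?A k - ?B k)) sums
      ((\<Sum>k. q ^ k * ?B k) + (\<Sum>k<N. q ^ k * (?A k - ?B k)))"
    by (rule sums_add[rotated])
  then have "(\<Sum>k. q ^ k * ?A k) = (\<Sum>k. q ^ k * ?B k) + (\<Sum>k<N. q ^ k * (?A k - ?B k))"
    by (simp add: right_diff_distrib sums_iff)
  then show ?thesis
    using q x
    by (simp add: hahn_integral0_def orbit_point_eq_funpow hahn_shifted_jet_lincomb_orbit distrib_left)
qed

lemma hahn_admissible_add_variation:
  assumes nbot: "at (hahn_omega0 q \<omega>) within I \<noteq> bot"
    and y: "y \<in> hahn_admissible q \<omega> I a b r \<alpha> \<beta>" and \<eta>: "\<eta> \<in> hahn_variations q \<omega> I a b r"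
  shows "(\<lambda>t. y t + e * \<eta> t) \<in> hahn_admissible q \<omega> I a b r \<alpha> \<beta>"
  using assms hahn_Y_lincomb[OF nbot, of y a b r \<eta> e] hahn_derivs_lincomb[OF nbot, of y a b r \<eta> _ e]
  by (auto simp: hahn_admissible_def hahn_variations_def)

text \<open>The norm of \<open>e * \<eta>\<close> is at most linear in \<open>\<bar>e\<bar>\<close>,
  so small multiples stay in the neighbourhood. The predicate \<open>P\<close> is left abstract to
  serve minimizers and maximizers alike.\<close>

lemma hahn_local_property_variation:
  assumes q: "0 < q" "q < 1" and nbot: "at (hahn_omega0 q \<omega>) within I \<noteq> bot"
    and local: "\<exists>\<delta>>0. \<forall>z\<in>hahn_admissible q \<omega> I a b r \<alpha> \<beta>.
        hahn_norm q \<omega> I a b r (\<lambda>t. y t - z t) < \<delta> \<longrightarrow> P z"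
    and y: "y \<in> hahn_admissible q \<omega> I a b r \<alpha> \<beta>" and \<eta>: "\<eta> \<in> hahn_variations q \<omega> I a b r"
  shows "\<exists>d>0. \<forall>e. \<bar>e\<bar> < d \<longrightarrow> P (\<lambda>t. y t + e * \<eta> t)"
proof -
  obtain \<delta> where \<delta>: "\<delta> > 0" and P: "\<And>z. z \<in> hahn_admissible q \<omega> I a b r \<alpha> \<beta> \<Longrightarrow>
      hahn_norm q \<omega> I a b r (\<lambda>t. y t - z t) < \<delta> \<Longrightarrow> P z"
    using local by blast
  \<comment> \<open>The absolute value and \<open>+ 1\<close> make the divisor positive without a
    sign argument for the norm.\<close>
  define B where "B = \<bar>hahn_norm q \<omega> I a b r \<eta>\<bar> + 1"
  have "B > 0" by (simp add: B_def)
  have "P (\<lambda>t. y t + e * \<eta> t)" if "\<bar>e\<bar> < \<delta> / B" for e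
  proof (rule P)
    show "(\<lambda>t. y t + e * \<eta> t) \<in> hahn_admissible q \<omega> I a b r \<alpha> \<beta>"
      by (rule hahn_admissible_add_variation[OF nbot y \<eta>])
    have "hahn_norm q \<omega> I a b r (\<lambda>t. y t - (y t + e * \<eta> t)) = hahn_norm q \<omega> I a b r (\<lambda>t. - e * \<eta> t)"
      by simp
    also have "\<dots> \<le> \<bar>- e\<bar> * hahn_norm q \<omega> I a b r \<eta>"
      using \<eta> by (intro hahn_norm_scale_le[OF q nbot]) (simp add: hahn_variations_def hahn_admissible_def)
    also have "\<dots> \<le> \<bar>e\<bar> * B"
      by (auto simp: B_def intro!: mult_left_mono)
    also have "\<dots> < \<delta>"
      using that \<open>B > 0\<close> by (simp add: pos_less_divide_eq)
    finally show "hahn_norm q \<omega> I a b r (\<lambda>t. y t - (y t + e * \<eta> t)) < \<delta>" .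
  qed
  then show ?thesis
    using \<delta> \<open>B > 0\<close> by (intro exI[of _ "\<delta> / B"]) auto
qed

lemma first_variation_eq_0:
  assumes q: "0 < q" "q < 1" and nbot: "at (hahn_omega0 q \<omega>) within I \<noteq> bot"
    and ends: "x = a \<and> x' = b \<or> x = b \<and> x' = a" and x: "x \<noteq> hahn_omega0 q \<omega>"
    and C1: "\<And>k. C1_tuples (Suc r) (L ((hahn_sigma q \<omega> ^^ k) x))"
    and extremizer: "hahn_local_minimizer q \<omega> I a b r \<alpha> \<beta> L y \<or>
      hahn_local_maximizer q \<omega> I a b r \<alpha> \<beta> L y"
    and \<eta>: "\<eta> \<in> hahn_variations q \<omega> I a b r"
    and \<eta>_x: "\<And>j. N \<le> j \<Longrightarrow> \<eta> ((hahn_sigma q \<omega> ^^ j) x) = 0"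
    and \<eta>_x': "\<And>j. \<eta> ((hahn_sigma q \<omega> ^^ j) x') = 0"
    and integrable: "hahn_integrable0 q \<omega> x (\<lambda>t. L t (hahn_shifted_jet q \<omega> I r y t))"
  shows "(\<Sum>k<N. q ^ k * (\<Sum>i\<le>r. hahn_EL_coeff q \<omega> I r L y i ((hahn_sigma q \<omega> ^^ k) x) *
    hahn_shifted_jet q \<omega> I r \<eta> ((hahn_sigma q \<omega> ^^ k) x) i)) = 0" (is "?S = 0")
proof -
  let ?\<L> = "hahn_functional q \<omega> I a b r L"
  \<comment> \<open>The sign records whether \<open>x\<close> is the upper or the lower limit of
    integration; the other factor is \<open>(1 - q) * (x - hahn_omega0 q \<omega>)\<close>, hence
    nonzero.\<close>
  define K where "K = (if x = b then 1 else - 1) * (x * (1 - q) - \<omega>)"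
  define G where "G e = (\<Sum>k<N. q ^ k *
    (L ((hahn_sigma q \<omega> ^^ k) x) (\<lambda>i. hahn_shifted_jet q \<omega> I r y ((hahn_sigma q \<omega> ^^ k) x) i +
        e * hahn_shifted_jet q \<omega> I r \<eta> ((hahn_sigma q \<omega> ^^ k) x) i) -
     L ((hahn_sigma q \<omega> ^^ k) x) (hahn_shifted_jet q \<omega> I r y ((hahn_sigma q \<omega> ^^ k) x))))" for e
  have "(1 - q) * hahn_omega0 q \<omega> = \<omega>"
    using q by (simp add: hahn_omega0_def)
  then have "x * (1 - q) - \<omega> = (1 - q) * (x - hahn_omega0 q \<omega>)"
    by (simp add: algebra_simps)
  then have "K \<noteq> 0"
    using x q by (simp add: K_def)
  have functional: "?\<L> (\<lambda>t. y t + e * \<eta> t) = ?\<L> y + K * G e" for e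
    using ends \<eta>_x'
      hahn_integral0_finite_variation[where L = L and I = I and r = r and y = y and e = e and N = N and \<eta> = \<eta>,
        OF q x \<eta>_x integrable]
      hahn_integral0_variation_eq[where L = L and I = I and r = r and y = y and e = e and \<eta> = \<eta>,
        OF q \<eta>_x']
    by (auto simp: hahn_functional_def hahn_integral_def K_def G_def algebra_simps)
  have "(G has_field_derivative ?S) (at 0)"
    unfolding G_def hahn_EL_coeff_def lessThan_Suc_atMost[symmetric]
    by (auto simp: mult.commute[of "q ^ _"] intro!: derivative_eq_intros
        C1_tuples_has_directional_derivative[OF C1 hahn_shifted_jet_mem_real_tuples hahn_shifted_jet_mem_real_tuples])
  then have deriv: "((\<lambda>e. ?\<L> (\<lambda>t. y t + e * \<eta> t)) has_field_derivative K * ?S) (at 0)"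
    unfolding functional by (auto intro!: derivative_eq_intros)
  have "K * ?S = 0"
    using extremizer
  proof
    assume min: "hahn_local_minimizer q \<omega> I a b r \<alpha> \<beta> L y"
    then obtain d where "d > 0" "\<forall>e. \<bar>e\<bar> < d \<longrightarrow> ?\<L> y \<le> ?\<L> (\<lambda>t. y t + e * \<eta> t)"
      using hahn_local_property_variation[OF q nbot, where P = "\<lambda>z. ?\<L> y \<le> ?\<L> z"] \<eta>
      unfolding hahn_local_minimizer_def by blast
    then show ?thesis
      by (intro DERIV_local_min[OF deriv]) auto
  next
    assume max: "hahn_local_maximizer q \<omega> I a b r \<alpha> \<beta> L y"
    then obtain d where "d > 0" "\<forall>e. \<bar>e\<bar> < d \<longrightarrow> ?\<L> y \<ge> ?\<L> (\<lambda>t. y t + e * \<eta> t)"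
      using hahn_local_property_variation[OF q nbot, where P = "\<lambda>z. ?\<L> y \<ge> ?\<L> z"] \<eta>
      unfolding hahn_local_maximizer_def by blast
    then show ?thesis
      by (intro DERIV_local_max[OF deriv]) auto
  qed
  with \<open>K \<noteq> 0\<close> show ?thesis by simp
qed

section \<open>One-point variations and the Euler-Lagrange equation\<close>

lemma hahn_point_variation:
  assumes q: "0 < q" "q < 1" and nbot: "at (hahn_omega0 q \<omega>) within I \<noteq> bot"
    and p: "p \<noteq> hahn_omega0 q \<omega>"
    and "\<And>j. j < r \<Longrightarrow> (hahn_sigma q \<omega> ^^ j) a \<noteq> p" "\<And>j. j < r \<Longrightarrow> (hahn_sigma q \<omega> ^^ j) b \<noteq> p"
  shows "indicator {p} \<in> hahn_variations q \<omega> I a b r"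
proof -
  \<comment> \<open>With the distance to \<open>p\<close> as radius, the open ball just misses
    \<open>p\<close>.\<close>
  have zero: "indicator {p} t = (0 :: real)" if "t \<in> ball (hahn_omega0 q \<omega>) (dist (hahn_omega0 q \<omega>) p)" for t
    using that by (auto simp: indicator_def)
  have "hahn_derivs q \<omega> I i (indicator {p}) x = 0"
    if "i < r" and x: "\<And>j. j < r \<Longrightarrow> (hahn_sigma q \<omega> ^^ j) x \<noteq> p" for i x
  proof (cases "x = hahn_omega0 q \<omega>")
    case True
    then show ?thesis
      using p hahn_derivs_eq_0_ball[OF q nbot zero] by simp
  next
    case False
    have "(qdiff q (x - hahn_omega0 q \<omega>) ^^ i) (\<lambda>k. indicator {p} ((hahn_sigma q \<omega> ^^ k) x)) 0 = 0"
      using that by (intro qdiff_power_eq_0) (auto simp: indicator_def)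
    then show ?thesis
      using hahn_derivs_orbit[OF q False, of I i "indicator {p}" 0] by simp
  qed
  moreover have "indicator {p} \<in> hahn_Y q \<omega> I a b r"
    using p by (intro vanishing_near_omega0_mem_hahn_Y[OF q nbot _ zero]) auto
  ultimately show ?thesis
    using assms by (auto simp: hahn_variations_def hahn_admissible_def)
qed

lemma euler_lagrange_orbit:
  assumes q: "0 < q" "q < 1" and nbot: "at (hahn_omega0 q \<omega>) within I \<noteq> bot"
    and ends: "x = a \<and> x' = b \<or> x = b \<and> x' = a" and x: "x \<noteq> hahn_omega0 q \<omega>"
    and disjoint: "\<And>m n. (hahn_sigma q \<omega> ^^ m) x \<noteq> (hahn_sigma q \<omega> ^^ n) x'"
    and C1: "\<And>k. C1_tuples (Suc r) (L ((hahn_sigma q \<omega> ^^ k) x))"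
    and extremizer: "hahn_local_minimizer q \<omega> I a b r \<alpha> \<beta> L y \<or>
      hahn_local_maximizer q \<omega> I a b r \<alpha> \<beta> L y"
    and integrable: "hahn_integrable0 q \<omega> x (\<lambda>t. L t (hahn_shifted_jet q \<omega> I r y t))"
  shows "(\<Sum>i\<le>r. (- 1) ^ i * (1 / q) ^ ((i - 1) * i div 2) *
    hahn_derivs q \<omega> I i (hahn_EL_coeff q \<omega> I r L y i) ((hahn_sigma q \<omega> ^^ k) x)) = 0"
proof -
  \<comment> \<open>The index is at least \<open>r\<close>, so the boundary conditions hold, and the
    offset \<open>r\<close> makes every order single out the same index \<open>k\<close> after
    summation by parts.\<close>
  define p where "p = (hahn_sigma q \<omega> ^^ (k + r)) x"
  define d where "d = x - hahn_omega0 q \<omega>"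
  define N where "N = Suc (k + r)"
  define f where "f i = (\<lambda>n. hahn_EL_coeff q \<omega> I r L y i ((hahn_sigma q \<omega> ^^ n) x))" for i
  \<comment> \<open>The indicator as seen by entry \<open>i\<close> of the shifted jet. Its only
    nonzero index is \<open>k + i\<close>, which is at least \<open>i\<close> and below
    \<open>N\<close>, as summation by parts requires; there \<open>h i (n + i)\<close> is nonzero
    exactly at \<open>n = k\<close>.\<close>
  define h where "h i n = (if r - i + n = k + r then 1 else 0 :: real)" for i n
  have p_iff: "(hahn_sigma q \<omega> ^^ n) x = p \<longleftrightarrow> n = k + r" for n
    using inj_hahn_sigma_funpow[OF q x] by (simp add: p_def)
  have not_p: "(hahn_sigma q \<omega> ^^ n) x' \<noteq> p" for n
    using disjoint[of "k + r" n] by (auto simp: p_def)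
  have "indicator {p} \<in> hahn_variations q \<omega> I a b r"
    using ends p_iff not_p q x
    by (intro hahn_point_variation[OF q nbot]) (auto simp: p_def hahn_sigma_funpow_eq_omega0_iff)
  then have "(\<Sum>n<N. q ^ n * (\<Sum>i\<le>r. f i n *
      hahn_shifted_jet q \<omega> I r (indicator {p}) ((hahn_sigma q \<omega> ^^ n) x) i)) = 0"
    unfolding f_def using p_iff not_p
    by (intro first_variation_eq_0[OF q nbot ends x C1 extremizer _ _ _ integrable])
      (auto simp: indicator_def N_def)
  moreover have "hahn_shifted_jet q \<omega> I r (indicator {p}) ((hahn_sigma q \<omega> ^^ n) x) i =
      (qdiff q d ^^ i) (h i) n" if "i \<le> r" for i n
    unfolding d_def h_def hahn_shifted_jet_orbit[OF q x that] indicator_def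
    by (simp add: p_iff of_bool_def)
  ultimately have "0 = (\<Sum>n<N. \<Sum>i\<le>r. q ^ n * f i n * (qdiff q d ^^ i) (h i) n)"
    by (simp add: sum_distrib_left mult.assoc)
  also have "\<dots> = (\<Sum>i\<le>r. \<Sum>n<N. q ^ n * f i n * (qdiff q d ^^ i) (h i) n)"
    by (rule sum.swap)
  also have "\<dots> = (\<Sum>i\<le>r. (- 1) ^ i * (1 / q) ^ ((i - 1) * i div 2) * (q ^ k * (qdiff q d ^^ i) (f i) k))"
  proof (rule sum.cong[OF refl])
    fix i assume "i \<in> {..r}"
    then have "i \<le> r" by simp
    have "(\<Sum>n<N. q ^ n * f i n * (qdiff q d ^^ i) (h i) n) =
      (- 1) ^ i * (1 / q) ^ ((i - 1) * i div 2) * (\<Sum>n<N. q ^ n * (qdiff q d ^^ i) (f i) n * h i (n + i))"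
      using q x \<open>i \<le> r\<close> by (intro sum_qdiff_power_by_parts) (auto simp: d_def h_def N_def)
    also have "(\<Sum>n<N. q ^ n * (qdiff q d ^^ i) (f i) n * h i (n + i)) =
        (\<Sum>n<N. if n = k then q ^ n * (qdiff q d ^^ i) (f i) n else 0)"
      using \<open>i \<le> r\<close> by (intro sum.cong) (auto simp: h_def)
    also have "\<dots> = q ^ k * (qdiff q d ^^ i) (f i) k"
      by (simp add: N_def)
    finally show "(\<Sum>n<N. q ^ n * f i n * (qdiff q d ^^ i) (h i) n) =
      (- 1) ^ i * (1 / q) ^ ((i - 1) * i div 2) * (q ^ k * (qdiff q d ^^ i) (f i) k)" .
  qed
  also have "\<dots> = q ^ k * (\<Sum>i\<le>r. (- 1) ^ i * (1 / q) ^ ((i - 1) * i div 2) * (qdiff q d ^^ i) (f i) k)"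
    by (simp add: sum_distrib_left mult.left_commute)
  finally show ?thesis
    using q x by (simp add: hahn_derivs_orbit d_def f_def)
qed

text \<open>If one end point lay on the orbit of the other, the common tails of the two series would
  cancel and the functional would not see the integrand there; hence \<open>orbits\<close>.
  \<open>H1\<close> also covers the grid, which leaves [a, b] when the fixed point lies outside. At
  the fixed point the derivatives of the coefficients are meaningful only under the stated
  membership in \<open>hahn_Y\<close>.\<close>

theorem theorem4p2p12:
  fixes q \<omega> a b :: real and I :: "real set" and r :: nat
    and \<alpha> \<beta> :: "nat \<Rightarrow> real" and L :: "real \<Rightarrow> (nat \<Rightarrow> real) \<Rightarrow> real" and ystar :: "real \<Rightarrow> real"
  assumes q: "0 < q" "q < 1" and omega: "0 \<le> \<omega>"
    and I: "is_interval I" "hahn_omega0 q \<omega> \<in> I"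
    and ab: "a \<in> I" "b \<in> I" "a < b"
    and orbits: "a \<notin> hahn_orbit q \<omega> b" "b \<notin> hahn_orbit q \<omega> a"
    and H1: "\<And>t. t \<in> {a..b} \<union> hahn_interval q \<omega> a b \<Longrightarrow> C1_tuples (Suc r) (L t)"
    and H2: "\<And>y. y \<in> hahn_admissible q \<omega> I a b r \<alpha> \<beta> \<Longrightarrow>
      continuous (at (hahn_omega0 q \<omega>) within I) (\<lambda>t. L t (hahn_jet q \<omega> I r y t))"
    and H3: "\<And>y i. y \<in> hahn_admissible q \<omega> I a b r \<alpha> \<beta> \<Longrightarrow> i \<le> r \<Longrightarrow>
      (\<lambda>t. partial i (L t) (hahn_jet q \<omega> I r y t)) \<in> hahn_Y q \<omega> I a b 1"
    and H4: "\<And>y \<eta>. y \<in> hahn_admissible q \<omega> I a b r \<alpha> \<beta> \<Longrightarrow>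
      \<eta> \<in> hahn_variations q \<omega> I a b r \<Longrightarrow>
      hahn_variation_regular q \<omega> a b
        (\<lambda>t \<epsilon>. L t (\<lambda>i. hahn_shifted_jet q \<omega> I r y t i + \<epsilon> * hahn_shifted_jet q \<omega> I r \<eta> t i))"
    and extremizer: "hahn_local_minimizer q \<omega> I a b r \<alpha> \<beta> L ystar \<or>
      hahn_local_maximizer q \<omega> I a b r \<alpha> \<beta> L ystar"
  shows "\<forall>t\<in>hahn_interval q \<omega> a b.
    (t = hahn_omega0 q \<omega> \<longrightarrow> (\<forall>i\<le>r. hahn_EL_coeff q \<omega> I r L ystar i \<in> hahn_Y q \<omega> I a b i)) \<longrightarrow>
    (\<Sum>i\<le>r. (- 1) ^ i * (1 / q) ^ ((i - 1) * i div 2) *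
       hahn_derivs q \<omega> I i (hahn_EL_coeff q \<omega> I r L ystar i) t) = 0"
proof -
  let ?w = "hahn_omega0 q \<omega>"
  define E where "E t = (\<Sum>i\<le>r. (- 1) ^ i * (1 / q) ^ ((i - 1) * i div 2) *
    hahn_derivs q \<omega> I i (hahn_EL_coeff q \<omega> I r L ystar i) t)" for t
  have nbot: "at ?w within I \<noteq> bot"
  proof (cases "a = ?w")
    case True
    with ab show ?thesis by (intro at_within_interval_neq_bot[OF I(1,2) ab(2)]) auto
  next
    case False
    then show ?thesis by (rule at_within_interval_neq_bot[OF I(1,2) ab(1)])
  qed
  have ystar: "ystar \<in> hahn_admissible q \<omega> I a b r \<alpha> \<beta>"
    using extremizer by (auto simp: hahn_local_minimizer_def hahn_local_maximizer_def)
  \<comment> \<open>The zero variation extracts from \<open>H4\<close>, at parameter 0, the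
    convergence of the series for \<open>ystar\<close> itself.\<close>
  have "(\<lambda>_. 0) \<in> hahn_variations q \<omega> I a b r"
    using vanishing_near_omega0_mem_hahn_Y[OF q nbot zero_less_one, of "\<lambda>_. 0"]
      hahn_derivs_zero_fun[OF q nbot]
    by (auto simp: hahn_variations_def hahn_admissible_def)
  from H4[OF ystar this]
  have "\<forall>\<^sub>F e in nhds 0. hahn_integrable0 q \<omega> a (\<lambda>t. L t (\<lambda>i. hahn_shifted_jet q \<omega> I r ystar t i +
      e * hahn_shifted_jet q \<omega> I r (\<lambda>_. 0) t i)) \<and>
    hahn_integrable0 q \<omega> b (\<lambda>t. L t (\<lambda>i. hahn_shifted_jet q \<omega> I r ystar t i +
      e * hahn_shifted_jet q \<omega> I r (\<lambda>_. 0) t i))"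
    by (simp add: hahn_variation_regular_def)
  from eventually_nhds_x_imp_x[OF this]
  have integrable: "hahn_integrable0 q \<omega> a (\<lambda>t. L t (hahn_shifted_jet q \<omega> I r ystar t))"
    "hahn_integrable0 q \<omega> b (\<lambda>t. L t (hahn_shifted_jet q \<omega> I r ystar t))"
    by simp_all
  have E_orbit: "E ((hahn_sigma q \<omega> ^^ k) x) = 0" if "x = a \<or> x = b" "x \<noteq> ?w" for x k
    unfolding E_def
  proof (rule euler_lagrange_orbit[OF q nbot _ that(2) _ _ extremizer])
    show "x = a \<and> (if x = a then b else a) = b \<or> x = b \<and> (if x = a then b else a) = a"
      using that by auto
    show "(hahn_sigma q \<omega> ^^ m) x \<noteq> (hahn_sigma q \<omega> ^^ n) (if x = a then b else a)" for m n
      using that hahn_orbits_disjoint[OF q orbits] hahn_orbits_disjoint[OF q orbits(2,1)] by auto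
    show "C1_tuples (Suc r) (L ((hahn_sigma q \<omega> ^^ k) x))" for k
      using that q by (intro H1) (auto simp: hahn_interval_def hahn_orbit_eq)
    show "hahn_integrable0 q \<omega> x (\<lambda>t. L t (hahn_shifted_jet q \<omega> I r ystar t))"
      using that integrable by auto
  qed
  have E_omega0: "E ?w = 0"
    if Y: "\<forall>i\<le>r. hahn_EL_coeff q \<omega> I r L ystar i \<in> hahn_Y q \<omega> I a b i"
  proof -
    \<comment> \<open>As \<open>a < b\<close>, at least one end point is not fixed. Its orbit stays
      in \<open>I\<close> and tends to the fixed point, and membership of coefficient
      \<open>i\<close> in the space of order \<open>i\<close> makes every summand of
      \<open>E\<close> continuous there.\<close>
    obtain x where x: "x = a \<or> x = b" "x \<noteq> ?w"
      using ab by (metis less_irrefl)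
    have "continuous (at ?w within I) E"
      unfolding E_def using Y by (intro continuous_intros) (auto simp: hahn_Y_def)
    moreover have "\<forall>\<^sub>F n in sequentially. (hahn_sigma q \<omega> ^^ n) x \<in> I"
      using x ab hahn_sigma_funpow_mem_interval[OF q I] by auto
    ultimately have "(\<lambda>n. E ((hahn_sigma q \<omega> ^^ n) x)) \<longlonglongrightarrow> E ?w"
      by (metis continuous_within_tendsto_compose hahn_sigma_funpow_LIMSEQ[OF q])
    then show ?thesis
      using E_orbit[OF x] by (simp add: LIMSEQ_const_iff)
  qed
  show ?thesis
  proof (intro ballI impI)
    fix t
    assume t: "t \<in> hahn_interval q \<omega> a b"
      and Y: "t = ?w \<longrightarrow> (\<forall>i\<le>r. hahn_EL_coeff q \<omega> I r L ystar i \<in> hahn_Y q \<omega> I a b i)"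
    have "E t = 0"
    proof (cases "t = ?w")
      case True
      with Y E_omega0 show ?thesis by simp
    next
      case False
      with t q obtain x k where "x = a \<or> x = b" "t = (hahn_sigma q \<omega> ^^ k) x"
        by (auto simp: hahn_interval_def hahn_orbit_eq)
      moreover from this False q have "x \<noteq> ?w"
        by (auto simp: hahn_sigma_funpow_eq_omega0_iff)
      ultimately show ?thesis using E_orbit by simp
    qed
    then show "(\<Sum>i\<le>r. (- 1) ^ i * (1 / q) ^ ((i - 1) * i div 2) *
        hahn_derivs q \<omega> I i (hahn_EL_coeff q \<omega> I r L ystar i) t) = 0"
      by (simp add: E_def)
  qed
qed

end
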